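(* Let $\phi:\mathbb{R}^n\times\mathbb{R}^m\to\mathbb{R}^m$ and $G:\mathbb{R}^n\times\mathbb{R}^m\to\mathbb{R}^p$ be continuously differentiable and $g:\mathbb{R}^m\to\mathbb{R}^q$ twice continuously differentiable, and let $$\widetilde\Omega:=\{(x,y,\lambda)\in\mathbb{R}^n\times\mathbb{R}^m\times\mathbb{R}^q\mid \phi(x,y)+\nabla g(y)^T\lambda=0,\ g(y)\le0,\ \lambda\ge0,\ \lambda^Tg(y)=0,\ G(x,y)\le0\}.$$ Let $(\bar x,\bar y,\bar\lambda)\in\widetilde\Omega$ and assume that there exists a second multiplier $\hat\lambda\ne\bar\lambda$ such that $(\bar x,\bar y,\hat\lambda)\in\widetilde\Omega$. Then for every partition $(\beta_1,\beta_2)$ of $\mathcal{I}_0$ the constraint system (branch) in the variables $(x,y,\lambda)$ $$\left\{\begin{array}{l} \phi(x,y)+\nabla g(y)^T\lambda=0,\\ g_i(y)=0,\ \lambda_i\ge0\ (i\in\mathcal{I}_g),\quad \lambda_i=0,\ g_i(y)\le0\ (i\in\mathcal{I}_\lambda),\\ g_i(y)=0,\ \lambda_i\ge0\ (i\in\beta_1),\quad g_i(y)\le0,\ \lambda_i=0\ (i\in\beta_2),\\ G(x,y)\le0 \end{array}\right.$$ does not fulfill the Mangasarian-Fromovitz constraint qualification (MFCQ) at $(\bar x,\bar y,\bar\lambda)$.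
   Context: Index sets at $(\bar x,\bar y,\bar\lambda)\in\widetilde\Omega$: $\mathcal{I}_g=\{i\in\{1,\dots,q\}\mid g_i(\bar y)=0,\ \bar\lambda_i>0\}$, $\mathcal{I}_\lambda=\{i\mid g_i(\bar y)<0,\ \bar\lambda_i=0\}$, $\mathcal{I}_0=\{i\mid g_i(\bar y)=0,\ \bar\lambda_i=0\}$. A partition $(\beta_1,\beta_2)$ of $\mathcal{I}_0$ is a pair of disjoint (possibly empty) sets with $\beta_1\cup\beta_2=\mathcal{I}_0$. MFCQ for a system of equality and inequality constraints at a feasible point: the gradients of all equality constraints are linearly independent, and there is a direction orthogonal to all of them that has strictly negative directional derivative for every active inequality constraint (written in the form $\le0$). *)

theory Defs
  imports "HOL-Analysis.Analysis"
begin

definition C1 :: "('a::real_normed_vector \<Rightarrow> 'b::real_normed_vector) \<Rightarrow> bool" where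
  "C1 f \<longleftrightarrow> (\<exists>f' :: 'a \<Rightarrow> 'a \<Rightarrow>\<^sub>L 'b.
     (\<forall>z. (f has_derivative blinfun_apply (f' z)) (at z)) \<and> continuous_on UNIV f')"

definition C2 :: "('a::real_normed_vector \<Rightarrow> 'b::real_normed_vector) \<Rightarrow> bool" where
  "C2 f \<longleftrightarrow> (\<exists>f' :: 'a \<Rightarrow> 'a \<Rightarrow>\<^sub>L 'b.
     (\<forall>z. (f has_derivative blinfun_apply (f' z)) (at z)) \<and> C1 f')"

definition gradient :: "('z::real_inner \<Rightarrow> real) \<Rightarrow> 'z \<Rightarrow> 'z" where
  "gradient f z = (THE D. GDERIV f z :> D)"

lemma gradient_eqI:
  assumes "GDERIV f z :> D"
  shows "gradient f z = D"
  unfolding gradient_def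
proof (rule the_equality)
  fix D' assume "GDERIV f z :> D'"
  with assms have "(\<lambda>h. h \<bullet> D') = (\<lambda>h. h \<bullet> D)"
    unfolding gderiv_def by (rule has_derivative_unique[rotated])
  then show "D' = D"
    by (simp only: fun_eq_iff vector_eq_ldot)
qed (fact assms)

text \<open>
  The Mangasarian-Fromovitz constraint qualification at \<open>z\<close> for the constraints \<open>h e = 0\<close>
  (\<open>e \<in> E\<close>) and \<open>c j \<le> 0\<close> (\<open>j \<in> J\<close>). Injectivity together with independence of the image says
  that the gradients are linearly independent as an indexed family, so a repeated equality
  constraint violates the condition. Feasibility of \<open>z\<close> is not part of the predicate, so its
  negation never holds merely because \<open>z\<close> is infeasible.
\<close>

definition MFCQ ::
  "'e set \<Rightarrow> ('e \<Rightarrow> 'z::real_inner \<Rightarrow> real) \<Rightarrow> 'j set \<Rightarrow> ('j \<Rightarrow> 'z \<Rightarrow> real) \<Rightarrow> 'z \<Rightarrow> bool" where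
  "MFCQ E h J c z \<longleftrightarrow>
     inj_on (\<lambda>e. gradient (h e) z) E \<and> independent ((\<lambda>e. gradient (h e) z) ` E) \<and>
     (\<exists>d. (\<forall>e\<in>E. gradient (h e) z \<bullet> d = 0) \<and>
          (\<forall>j\<in>J. c j z = 0 \<longrightarrow> gradient (c j) z \<bullet> d < 0))"

text \<open>The order on vectors is componentwise; \<open>jacobian g (at y)\<close> is \<open>\<nabla>g(y)\<close>, with one row per
  component of \<open>g\<close>.\<close>

definition Omega_tilde ::
  "((real^'n) \<times> (real^'m) \<Rightarrow> real^'m) \<Rightarrow> (real^'m \<Rightarrow> real^'q) \<Rightarrow> ((real^'n) \<times> (real^'m) \<Rightarrow> real^'p)
    \<Rightarrow> ((real^'n) \<times> (real^'m) \<times> (real^'q)) set" where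
  "Omega_tilde \<phi> g G = {(x, y, l).
     \<phi> (x, y) + transpose (jacobian g (at y)) *v l = 0 \<and>
     g y \<le> 0 \<and> 0 \<le> l \<and> l \<bullet> g y = 0 \<and> G (x, y) \<le> 0}"

definition I_g :: "(real^'m \<Rightarrow> real^'q) \<Rightarrow> real^'m \<Rightarrow> real^'q \<Rightarrow> 'q set" where
  "I_g g y l = {i. g y $ i = 0 \<and> l $ i > 0}"

definition I_lambda :: "(real^'m \<Rightarrow> real^'q) \<Rightarrow> real^'m \<Rightarrow> real^'q \<Rightarrow> 'q set" where
  "I_lambda g y l = {i. g y $ i < 0 \<and> l $ i = 0}"

definition I_0 :: "(real^'m \<Rightarrow> real^'q) \<Rightarrow> real^'m \<Rightarrow> real^'q \<Rightarrow> 'q set" where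
  "I_0 g y l = {i. g y $ i = 0 \<and> l $ i = 0}"

text \<open>
  Each scalar constraint of a branch has its own label. \<open>A\<close> is the set of indices \<open>i\<close> with
  \<open>g_i(y) = 0, \<lambda>_i \<ge> 0\<close> and \<open>B\<close> the set of indices with \<open>g_i(y) \<le> 0, \<lambda>_i = 0\<close>.
\<close>

datatype ('m, 'q) eq_label = Stationarity 'm | Lower_zero 'q | Lambda_zero 'q

datatype ('q, 'p) ineq_label = Lambda_nonneg 'q | Lower_nonpos 'q | Upper_nonpos 'p

definition branch_eqs :: "'q set \<Rightarrow> 'q set \<Rightarrow> ('m, 'q) eq_label set" where
  "branch_eqs A B = range Stationarity \<union> Lower_zero ` A \<union> Lambda_zero ` B"

definition branch_ineqs :: "'q set \<Rightarrow> 'q set \<Rightarrow> ('q, 'p) ineq_label set" where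
  "branch_ineqs A B = Lambda_nonneg ` A \<union> Lower_nonpos ` B \<union> range Upper_nonpos"

fun eq_constraint ::
  "((real^'n) \<times> (real^'m) \<Rightarrow> real^'m) \<Rightarrow> (real^'m \<Rightarrow> real^'q)
    \<Rightarrow> ('m, 'q) eq_label \<Rightarrow> (real^'n) \<times> (real^'m) \<times> (real^'q) \<Rightarrow> real" where
  "eq_constraint \<phi> g (Stationarity k) (x, y, l) =
     (\<phi> (x, y) + transpose (jacobian g (at y)) *v l) $ k"
| "eq_constraint \<phi> g (Lower_zero i) (x, y, l) = g y $ i"
| "eq_constraint \<phi> g (Lambda_zero i) (x, y, l) = l $ i"

fun ineq_constraint ::
  "(real^'m \<Rightarrow> real^'q) \<Rightarrow> ((real^'n) \<times> (real^'m) \<Rightarrow> real^'p)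
    \<Rightarrow> ('q, 'p) ineq_label \<Rightarrow> (real^'n) \<times> (real^'m) \<times> (real^'q) \<Rightarrow> real" where
  "ineq_constraint g G (Lambda_nonneg i) (x, y, l) = - (l $ i)"
| "ineq_constraint g G (Lower_nonpos i) (x, y, l) = g y $ i"
| "ineq_constraint g G (Upper_nonpos k) (x, y, l) = G (x, y) $ k"

lemma branch_system_iff:
  "(\<forall>e\<in>branch_eqs A B. eq_constraint \<phi> g e (x, y, l) = 0) \<and>
   (\<forall>j\<in>branch_ineqs A B. ineq_constraint g G j (x, y, l) \<le> 0) \<longleftrightarrow>
   \<phi> (x, y) + transpose (jacobian g (at y)) *v l = 0 \<and>
   (\<forall>i\<in>A. g y $ i = 0 \<and> l $ i \<ge> 0) \<and> (\<forall>i\<in>B. l $ i = 0 \<and> g y $ i \<le> 0) \<and>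
   G (x, y) \<le> 0"
  unfolding branch_eqs_def branch_ineqs_def
  by (simp only: ball_Un ball_simps eq_constraint.simps ineq_constraint.simps vec_eq_iff
      less_eq_vec_def zero_index neg_le_0_iff_le) blast

definition branch_MFCQ ::
  "((real^'n) \<times> (real^'m) \<Rightarrow> real^'m) \<Rightarrow> (real^'m \<Rightarrow> real^'q) \<Rightarrow> ((real^'n) \<times> (real^'m) \<Rightarrow> real^'p)
    \<Rightarrow> 'q set \<Rightarrow> 'q set \<Rightarrow> (real^'n) \<times> (real^'m) \<times> (real^'q) \<Rightarrow> bool" where
  "branch_MFCQ \<phi> g G A B z \<longleftrightarrow>
     MFCQ (branch_eqs A B) (eq_constraint \<phi> g) (branch_ineqs A B) (ineq_constraint g G) z"

end

theory Submission
  imports Defs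
begin

text \<open>
  Put \<open>\<mu> = lhat - lbar \<noteq> 0\<close>. Subtracting the two stationarity equations gives
  \<open>\<nabla>g(y)\<^sup>T \<mu> = 0\<close>, complementarity makes \<open>\<mu>\<close> vanish at inactive indices, and \<open>\<mu> \<ge> 0\<close> on
  \<open>\<beta>2\<close>, where \<open>lbar\<close> is zero. If \<open>\<mu>\<close> vanishes on \<open>\<beta>2\<close>, then it is a nontrivial linear
  relation between the gradients of the constraints \<open>g_i(y) = 0\<close>. Otherwise pairing the relation
  with the \<open>y\<close>-part of an MFCQ direction gives a negative number, while it should be \<open>0\<close>.
\<close>

text \<open>\<open>independent\<close> speaks of sets, while MFCQ needs an indexed family;
  injectivity of \<open>f\<close> lets a relation over \<open>T\<close> be reindexed as one over the
  image.\<close>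

lemma independent_family_coeff_zero:
  fixes f :: "'e \<Rightarrow> 'v::real_vector"
  assumes inj: "inj_on f T" and ind: "independent (f ` T)" and "finite T"
    and sum: "(\<Sum>e\<in>T. u e *\<^sub>R f e) = 0" and "e \<in> T"
  shows "u e = 0"
proof -
  have "(\<Sum>v\<in>f ` T. u (inv_into T f v) *\<^sub>R v) = (\<Sum>e\<in>T. u e *\<^sub>R f e)"
    by (simp add: sum.reindex[OF inj] inj)
  with sum have "(\<Sum>v\<in>f ` T. u (inv_into T f v) *\<^sub>R v) = 0"
    by simp
  from independentD[OF ind _ _ this, of "f e"] show ?thesis
    using \<open>finite T\<close> \<open>e \<in> T\<close> inj by simp
qed

lemma C2_differentiable: "C2 f \<Longrightarrow> f differentiable (at z)"
  unfolding C2_def differentiable_def by blast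

text \<open>Chain rule through the projection to the \<open>y\<close>-block; the constraint ignores
  \<open>x\<close> and \<lambda>, so these blocks of the gradient vanish.\<close>

lemma gradient_lower_component:
  fixes g :: "real^'m \<Rightarrow> real^'q"
  assumes "g differentiable (at y)"
  shows "gradient (\<lambda>z :: (real^'n) \<times> (real^'m) \<times> (real^'q). g (fst (snd z)) $ i) (x, y, l)
    = (0, row i (jacobian g (at y)), 0)"
proof (rule gradient_eqI, unfold gderiv_def)
  let ?J = "jacobian g (at y)"
  let ?z = "(x, y, l)"
  have "((\<lambda>z. fst (snd z)) has_derivative (\<lambda>h. fst (snd h))) (at ?z)"
    by (intro derivative_intros)
  moreover have "(g has_derivative (\<lambda>h. ?J *v h)) (at (fst (snd ?z)))"
    using assms by (simp flip: jacobian_works)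
  ultimately have "((\<lambda>z. g (fst (snd z))) has_derivative (\<lambda>h. ?J *v fst (snd h))) (at ?z)"
    by (rule has_derivative_compose)
  then have "((\<lambda>z. g (fst (snd z)) $ i) has_derivative (\<lambda>h. (?J *v fst (snd h)) $ i)) (at ?z)"
    by (rule bounded_linear.has_derivative[OF bounded_linear_vec_nth])
  moreover have "(\<lambda>h :: (real^'n) \<times> (real^'m) \<times> (real^'q). (?J *v fst (snd h)) $ i)
      = (\<lambda>h. h \<bullet> (0, row i ?J, 0))"
    by (auto simp: fun_eq_iff inner_prod_def matrix_vector_mul_component row_def inner_commute)
  ultimately show "((\<lambda>z. g (fst (snd z)) $ i) has_derivative (\<lambda>h. h \<bullet> (0, row i ?J, 0))) (at ?z)"
    by simp
qed

text \<open>Replaces pattern matching on triples by projections, the form in which the gradient was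
  computed.\<close>

lemma eq_constraint_Lower_zero:
  "eq_constraint \<phi> g (Lower_zero i) = (\<lambda>z. g (fst (snd z)) $ i)"
  by (auto simp: fun_eq_iff)

lemma ineq_constraint_Lower_nonpos:
  "ineq_constraint g G (Lower_nonpos i) = (\<lambda>z. g (fst (snd z)) $ i)"
  by (auto simp: fun_eq_iff)

lemma transpose_mult_vec_eq_sum_rows:
  fixes M :: "real^'m^'q"
  shows "transpose M *v v = (\<Sum>i\<in>UNIV. v $ i *\<^sub>R row i M)"
  by (simp add: vec_eq_iff matrix_vector_mult_def transpose_def row_def mult.commute)

text \<open>The signs of \<open>l\<close> and \<open>g y\<close> make every summand of
  \<open>l \<bullet> g y\<close> nonpositive, so a zero sum forces each summand to be zero.\<close>

lemma Omega_tilde_complementarity: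
  assumes "(x, y, l) \<in> Omega_tilde \<phi> g G"
  shows "l $ i * g y $ i = 0"
proof -
  have "l $ j * g y $ j \<le> 0" for j
    using assms by (auto simp: Omega_tilde_def less_eq_vec_def intro: mult_nonneg_nonpos)
  moreover have "(\<Sum>j\<in>UNIV. l $ j * g y $ j) = 0"
    using assms by (simp add: Omega_tilde_def inner_vec_def)
  ultimately show ?thesis
    using sum_nonneg_eq_0_iff[of UNIV "\<lambda>j. - (l $ j * g y $ j)"] by (simp add: sum_negf)
qed

theorem proposition5:
  fixes \<phi> :: "(real^'n) \<times> (real^'m) \<Rightarrow> real^'m"
    and G :: "(real^'n) \<times> (real^'m) \<Rightarrow> real^'p"
    and g :: "real^'m \<Rightarrow> real^'q"
    and xbar :: "real^'n" and ybar :: "real^'m" and lbar lhat :: "real^'q"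
    and \<beta>1 \<beta>2 :: "'q set"
  assumes "C1 \<phi>" and "C1 G" and "C2 g"
    and "(xbar, ybar, lbar) \<in> Omega_tilde \<phi> g G"
    and "lhat \<noteq> lbar" and "(xbar, ybar, lhat) \<in> Omega_tilde \<phi> g G"
    and "\<beta>1 \<inter> \<beta>2 = {}" and "\<beta>1 \<union> \<beta>2 = I_0 g ybar lbar"
  shows "\<not> branch_MFCQ \<phi> g G (I_g g ybar lbar \<union> \<beta>1) (I_lambda g ybar lbar \<union> \<beta>2)
           (xbar, ybar, lbar)"
proof
  let ?A = "I_g g ybar lbar \<union> \<beta>1" and ?B = "I_lambda g ybar lbar \<union> \<beta>2"
  let ?z = "(xbar, ybar, lbar)"
  let ?r = "\<lambda>i. row i (jacobian g (at ybar))"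
  let ?D = "\<lambda>e. gradient (eq_constraint \<phi> g e) ?z"
  define \<mu> where "\<mu> = lhat - lbar"
  assume "branch_MFCQ \<phi> g G ?A ?B ?z"
  then obtain d where inj: "inj_on ?D (branch_eqs ?A ?B)"
    and ind: "independent (?D ` branch_eqs ?A ?B)"
    and d_eq: "\<And>e. e \<in> branch_eqs ?A ?B \<Longrightarrow> ?D e \<bullet> d = 0"
    and d_ineq: "\<And>j. \<lbrakk>j \<in> branch_ineqs ?A ?B; ineq_constraint g G j ?z = 0\<rbrakk>
      \<Longrightarrow> gradient (ineq_constraint g G j) ?z \<bullet> d < 0"
    unfolding branch_MFCQ_def MFCQ_def by blast
  note grad = gradient_lower_component[OF C2_differentiable[OF assms(3)]]
  have D: "?D (Lower_zero i) = (0, ?r i, 0)" for i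
    unfolding eq_constraint_Lower_zero by (rule grad)
  have \<mu>_rel: "(\<Sum>i\<in>UNIV. \<mu> $ i *\<^sub>R ?r i) = 0"
  proof -
    \<comment> \<open>Both multipliers belong to the same \<open>(xbar, ybar)\<close>, so the
      \<phi>-terms agree and cancel.\<close>
    have "transpose (jacobian g (at ybar)) *v lhat = transpose (jacobian g (at ybar)) *v lbar"
      using assms(4,6) by (simp add: Omega_tilde_def add_eq_0_iff2)
    then have "transpose (jacobian g (at ybar)) *v \<mu> = 0"
      unfolding \<mu>_def matrix_vector_mult_diff_distrib by (simp only: diff_self)
    then show ?thesis
      by (simp only: transpose_mult_vec_eq_sum_rows)
  qed
  have cover: "i \<in> ?A \<or> i \<in> ?B" for i
  proof -
    have "g ybar $ i \<le> 0" "0 \<le> lbar $ i" "lbar $ i * g ybar $ i = 0"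
      using assms(4) Omega_tilde_complementarity[OF assms(4)]
      by (auto simp: Omega_tilde_def less_eq_vec_def)
    then have "i \<in> I_g g ybar lbar \<union> I_lambda g ybar lbar \<union> I_0 g ybar lbar"
      by (auto simp: I_g_def I_lambda_def I_0_def)
    then show ?thesis
      using assms(8) by blast
  qed
  have \<mu>_inactive: "\<mu> $ i = 0" if "i \<in> I_lambda g ybar lbar" for i
    using that Omega_tilde_complementarity[OF assms(6), of i] by (simp add: I_lambda_def \<mu>_def)
  have \<mu>_nonneg: "\<mu> $ i \<ge> 0" and g_zero: "g ybar $ i = 0" if "i \<in> \<beta>2" for i
  proof -
    have "i \<in> I_0 g ybar lbar"
      using that assms(8) by blast
    then show "\<mu> $ i \<ge> 0" "g ybar $ i = 0"
      using assms(6) by (auto simp: I_0_def \<mu>_def Omega_tilde_def less_eq_vec_def)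
  qed
  show False
  proof (cases "\<forall>i\<in>\<beta>2. \<mu> $ i = 0")
    case True
    \<comment> \<open>An index outside \<open>?A\<close> lies in \<open>I_lambda\<close> or in
      \<beta>2, and \<mu> vanishes on both.\<close>
    then have off: "\<mu> $ i = 0" if "i \<notin> ?A" for i
      using that cover[of i] \<mu>_inactive by blast
    have "(\<Sum>i\<in>?A. \<mu> $ i *\<^sub>R ?r i) = 0"
      using \<mu>_rel sum.mono_neutral_left[of UNIV ?A "\<lambda>i. \<mu> $ i *\<^sub>R ?r i"] off by auto
    \<comment> \<open>The outer blocks of these gradients are zero, so the relation between the rows
      lifts to the full space.\<close>
    then have rel: "(\<Sum>i\<in>?A. \<mu> $ i *\<^sub>R ?D (Lower_zero i)) = 0"
      by (simp add: D prod_eq_iff fst_sum snd_sum)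
    have sub: "Lower_zero ` ?A \<subseteq> branch_eqs ?A ?B"
      by (auto simp: branch_eqs_def)
    have "inj_on (\<lambda>i. ?D (Lower_zero i)) ?A"
      using inj_on_subset[OF inj sub] by (auto simp: inj_on_def)
    moreover have "independent ((\<lambda>i. ?D (Lower_zero i)) ` ?A)"
      using sub by (intro independent_mono[OF ind]) auto
    ultimately have "\<mu> $ i = 0" if "i \<in> ?A" for i
      using that by (rule independent_family_coeff_zero[OF _ _ finite rel])
    with off have "\<mu> = 0"
      by (simp only: vec_eq_iff zero_index) blast
    with assms(5) show False
      by (simp add: \<mu>_def)
  next
    case False
    then obtain k where k: "k \<in> \<beta>2" "\<mu> $ k > 0"
      using \<mu>_nonneg by force
    have zero: "?r i \<bullet> fst (snd d) = 0" if "i \<in> ?A" for i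
      using that d_eq[of "Lower_zero i"] by (simp add: D branch_eqs_def inner_prod_def)
    \<comment> \<open>By \<open>g_zero\<close> the inequality is active on \<beta>2, so the MFCQ
      direction must strictly decrease it.\<close>
    have neg: "?r i \<bullet> fst (snd d) < 0" if "i \<in> \<beta>2" for i
      using that d_ineq[of "Lower_nonpos i"] g_zero[of i]
      by (simp add: ineq_constraint_Lower_nonpos grad branch_ineqs_def inner_prod_def)
    \<comment> \<open>The second factor is zero on \<open>?A\<close>, the first is zero on
      \<open>I_lambda\<close>, and on \<beta>2 the signs are opposite.\<close>
    have "\<mu> $ i * (?r i \<bullet> fst (snd d)) \<le> 0" for i
      using cover[of i] zero[of i] \<mu>_inactive[of i] \<mu>_nonneg[of i] neg[of i]
      by (auto intro: mult_nonneg_nonpos)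
    moreover have "\<mu> $ k * (?r k \<bullet> fst (snd d)) < 0"
      using k neg by (simp add: mult_pos_neg)
    \<comment> \<open>The summand at \<open>k\<close> makes the inequality strict.\<close>
    ultimately have "(\<Sum>i\<in>UNIV. \<mu> $ i * (?r i \<bullet> fst (snd d))) < (\<Sum>i\<in>(UNIV :: 'q set). 0)"
      by (intro sum_strict_mono_ex1) auto
    moreover have "(\<Sum>i\<in>UNIV. \<mu> $ i * (?r i \<bullet> fst (snd d))) = 0"
      using arg_cong[OF \<mu>_rel, of "\<lambda>v. v \<bullet> fst (snd d)"] by (simp add: inner_sum_left)
    ultimately show False
      by simp
  qed
qed

end
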